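(* Let $n,m\geq1$, $A,C\in\mathbb{R}^{n\times n}$ and $B\in\mathbb{R}^{n\times m}$. For each integer $k\ge0$ let $V_k=\mathrm{span}\{\mathrm{im}(MB): M\in\mathcal{W}_k(A,C)\}\subseteq\mathbb{R}^n$. Then there exists an integer $0\le k\leq n-1$ such that $V_k=V_{k+1}=V_{k+2}=\cdots$.
   Context: For an integer $k\geq0$, a word of length $k$ over $\{A,C\}$ is a matrix of the form $X_1X_2\cdots X_k$ with each $X_i\in\{A,C\}$ (the empty product, $k=0$, being the identity $I$). $\mathcal{W}_k(A,C)$ denotes the set of all words of length at most $k$ over $\{A,C\}$. $\mathrm{im}$ denotes the image (column space) of a matrix. *)

theory Defs
  imports "HOL-Analysis.Analysis"
begin

definition mat_prod_list :: "(real ^ 'n ^ 'n) list \<Rightarrow> real ^ 'n ^ 'n" where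
  "mat_prod_list Xs = foldr (**) Xs (mat 1)"

definition is_word :: "real ^ 'n ^ 'n \<Rightarrow> real ^ 'n ^ 'n \<Rightarrow> nat \<Rightarrow> real ^ 'n ^ 'n \<Rightarrow> bool" where
  "is_word A C k M \<longleftrightarrow> (\<exists>Xs. length Xs = k \<and> set Xs \<subseteq> {A, C} \<and> M = mat_prod_list Xs)"

definition words_upto :: "nat \<Rightarrow> real ^ 'n ^ 'n \<Rightarrow> real ^ 'n ^ 'n \<Rightarrow> (real ^ 'n ^ 'n) set" where
  "words_upto k A C = {M. \<exists>l\<le>k. is_word A C l M}"

definition mat_image :: "real ^ 'm ^ 'n \<Rightarrow> (real ^ 'n) set" where
  "mat_image M = range (\<lambda>x. M *v x)"

(* V_k; in real ^ 'm ^ 'n the outer index 'n counts rows, so B is an n x m matrix. *)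
definition word_span ::
  "real ^ 'n ^ 'n \<Rightarrow> real ^ 'n ^ 'n \<Rightarrow> real ^ 'm ^ 'n \<Rightarrow> nat \<Rightarrow> (real ^ 'n) set" where
  "word_span A C B k = span (\<Union>M\<in>words_upto k A C. mat_image (M ** B))"

end

theory Submission
  imports Defs
begin

text \<open>
  Splitting off the leftmost letter of a word shows that \<open>V\<^sub>k\<^sub>+\<^sub>1\<close> is a function of \<open>V\<^sub>k\<close>, namely
  \<open>V\<^sub>k\<^sub>+\<^sub>1 = im B + A V\<^sub>k + C V\<^sub>k\<close> (\<open>word_span_Suc\<close>). Hence one equality \<open>V\<^sub>k = V\<^sub>k\<^sub>+\<^sub>1\<close> makes the
  chain constant from \<open>k\<close> on. As long as the chain has not stalled, the dimension grows by at
  least one at each step, and it cannot exceed \<open>n\<close>, so the chain stalls at some index at most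
  \<open>n - dim V\<^sub>0\<close> (\<open>subspace_chain_stabilizes\<close>). If \<open>B \<noteq> 0\<close>, then \<open>dim V\<^sub>0 \<ge> 1\<close> and this index is at
  most \<open>n - 1\<close>. If \<open>B = 0\<close>, every \<open>V\<^sub>k\<close> is zero and \<open>k = 0\<close> works.
\<close>

text \<open>
  The hypothesis \<open>stall\<close> holds whenever the chain is generated by iterating one map. It excludes
  chains that pause and then grow again, for which the dimension count would bound only
  the number of jumps and not the index of the last one.
\<close>

lemma subspace_chain_stabilizes:
  fixes U :: "nat \<Rightarrow> 'a::euclidean_space set"
  assumes sub: "\<And>j. subspace (U j)"
    and mono: "\<And>j. U j \<subseteq> U (Suc j)"
    and stall: "\<And>j. U (Suc j) = U j \<Longrightarrow> U (Suc (Suc j)) = U (Suc j)"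
  shows "\<exists>k \<le> DIM('a) - dim (U 0). \<forall>j\<ge>k. U j = U k"
proof -
  define d where "d = DIM('a) - dim (U 0)"
  have "\<exists>k\<le>d. U (Suc k) = U k"
  proof (rule ccontr)
    assume "\<not> ?thesis"
    then have grow: "U (Suc k) \<noteq> U k" if "k \<le> d" for k
      using that by blast
    have "dim (U 0) + j \<le> dim (U j)" if "j \<le> Suc d" for j
      using that
    proof (induction j)
      case (Suc j)
      then have "U j \<subset> U (Suc j)"
        using mono[of j] grow[of j] by auto
      then have "dim (U j) < dim (U (Suc j))"
        by (intro dim_psubset) (simp add: span_eq_iff[THEN iffD2, OF sub])
      then show ?case
        using Suc by simp
    qed simp
    from this[of "Suc d"] have "DIM('a) < dim (U (Suc d))"
      by (simp add: d_def)
    then show False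
      using dim_subset_UNIV[of "U (Suc d)"] by simp
  qed
  then obtain k where "k \<le> d" and k: "U (Suc k) = U k"
    by blast
  have "U (Suc j) = U j \<and> U j = U k" if "j \<ge> k" for j
    using that
  proof (induction j rule: dec_induct)
    case (step j)
    then show ?case
      using stall[of j] by simp
  qed (simp add: k)
  with \<open>k \<le> d\<close> show ?thesis
    unfolding d_def by blast
qed

lemma words_upto_0: "words_upto 0 A C = {mat 1}"
  by (auto simp: words_upto_def is_word_def mat_prod_list_def)

lemma is_word_Suc:
  "is_word A C (Suc l) M \<longleftrightarrow> (\<exists>N. is_word A C l N \<and> (M = A ** N \<or> M = C ** N))"
proof
  assume "is_word A C (Suc l) M"
  then obtain X Xs where "length Xs = l" "set (X # Xs) \<subseteq> {A, C}" "M = X ** mat_prod_list Xs"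
    by (force simp: is_word_def mat_prod_list_def length_Suc_conv)
  then show "\<exists>N. is_word A C l N \<and> (M = A ** N \<or> M = C ** N)"
    unfolding is_word_def by auto
next
  assume "\<exists>N. is_word A C l N \<and> (M = A ** N \<or> M = C ** N)"
  then obtain X Xs where "length Xs = l" "X \<in> {A, C}" "set Xs \<subseteq> {A, C}"
      and "M = X ** mat_prod_list Xs"
    unfolding is_word_def by blast
  then show "is_word A C (Suc l) M"
    unfolding is_word_def by (intro exI[of _ "X # Xs"]) (simp add: mat_prod_list_def)
qed

lemma words_upto_Suc:
  "words_upto (Suc k) A C =
     {mat 1} \<union> (**) A ` words_upto k A C \<union> (**) C ` words_upto k A C"
proof -
  have "words_upto (Suc k) A C = {M. is_word A C 0 M \<or> (\<exists>l\<le>k. is_word A C (Suc l) M)}"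
    unfolding words_upto_def by (metis (no_types) Suc_le_mono not0_implies_Suc zero_le)
  also have "\<dots> = {mat 1} \<union> (**) A ` words_upto k A C \<union> (**) C ` words_upto k A C"
    unfolding is_word_Suc by (auto simp: words_upto_def is_word_def mat_prod_list_def)
  finally show ?thesis .
qed

lemma mat_image_mult: "mat_image (M ** N) = (*v) M ` mat_image N"
  by (auto simp: mat_image_def matrix_vector_mul_assoc[symmetric])

lemma word_span_0: "word_span A C B 0 = mat_image B"
proof -
  have "subspace (mat_image B)"
    unfolding mat_image_def by (intro linear_subspace_image) auto
  then show ?thesis
    by (simp add: word_span_def words_upto_0)
qed

text \<open>
  Letters are split off on the left: the letter then acts after everything else, and by linearity
  it may be applied to the previous span instead of to its generators. Splitting off the last
  letter would change \<open>B\<close> and give no recursion for the chain of a fixed \<open>B\<close>.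
\<close>

lemma word_span_Suc:
  "word_span A C B (Suc k) =
     span (mat_image B \<union> (*v) A ` word_span A C B k \<union> (*v) C ` word_span A C B k)"
proof -
  define S where "S = (\<Union>M\<in>words_upto k A C. mat_image (M ** B))"
  have "(\<Union>M\<in>words_upto (Suc k) A C. mat_image (M ** B)) =
      mat_image B \<union> (*v) A ` S \<union> (*v) C ` S"
    unfolding words_upto_Suc S_def
    by (simp add: matrix_mul_assoc[symmetric] mat_image_mult[of A] mat_image_mult[of C]
        image_Union image_image UN_Un Un_assoc)
  moreover have "span (mat_image B \<union> (*v) A ` S \<union> (*v) C ` S) =
      span (mat_image B \<union> (*v) A ` span S \<union> (*v) C ` span S)"
    by (simp add: span_Un linear_span_image[OF matrix_vector_mul_linear] span_span)
  ultimately show ?thesis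
    by (simp add: word_span_def S_def)
qed

lemma word_span_mono: "word_span A C B k \<subseteq> word_span A C B (Suc k)"
  unfolding word_span_def
  by (intro span_mono UN_mono) (auto simp: words_upto_def intro: le_SucI)

theorem proposition3p2:
  fixes A C :: "real ^ 'n ^ 'n" and B :: "real ^ 'm ^ 'n"
  shows "\<exists>k::nat. k \<le> CARD('n) - 1 \<and> (\<forall>j\<ge>k. word_span A C B j = word_span A C B k)"
proof (cases "dim (word_span A C B 0) = 0")
  case True
  then have zero: "word_span A C B 0 = {0}"
    using span_0 by (auto simp: word_span_0 mat_image_def intro: image_eqI[of _ _ 0])
  have "word_span A C B j = {0}" for j
  proof (induction j)
    case (Suc j)
    then show ?case
      using zero by (simp add: word_span_Suc flip: word_span_0[of A C B])
  qed (rule zero)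
  then show ?thesis
    by auto
next
  case False
  have "\<exists>k \<le> DIM(real ^ 'n) - dim (word_span A C B 0).
      \<forall>j\<ge>k. word_span A C B j = word_span A C B k"
  proof (rule subspace_chain_stabilizes)
    show "subspace (word_span A C B j)" for j
      by (simp add: word_span_def)
    show "word_span A C B (Suc (Suc j)) = word_span A C B (Suc j)"
      if "word_span A C B (Suc j) = word_span A C B j" for j
      unfolding word_span_Suc[of _ _ _ "Suc j"] that
      unfolding word_span_Suc[symmetric] by (rule that)
  qed (rule word_span_mono)
  moreover have "DIM(real ^ 'n) - dim (word_span A C B 0) \<le> CARD('n) - 1"
    using False by (simp del: dim_eq_0)
  ultimately show ?thesis
    using le_trans by blast
qed

end
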